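(* For each $j=1,\dots,m$, the gain function $\nabla\varphi_j(\mathbf{x})$ in the equation $$\nabla^T\left(p_t^{N_p,\Sigma}(\mathbf{x})\nabla\varphi_j(\mathbf{x})\right)=-\left(h_j(\mathbf{x})-\hat h_j^{N_p}\right)p_t^{N_p,\Sigma}(\mathbf{x})$$ is given by $$\nabla\varphi_j(\mathbf{x})=\frac{1}{\sum_{i=1}^{N_p}\mathcal{N}(\mathbf{x};X_t^i,\Sigma)}\cdot\sum_{i=1}^{N_p}\left[\nabla_{\vec\lambda}\psi_j^i(\mathbf{x})+\mathcal{N}(\mathbf{x};X_t^i,\Sigma)\nabla\varphi_j^i(\mathbf{x})\right],$$ where $\vec\lambda=(\lambda_1,\dots,\lambda_d)$ represents the eigenvalues of $\Sigma^{-1}$, and $\nabla_{\vec\lambda}\psi_j^i(\mathbf{x}):=\left(\frac{1}{\lambda_l}\frac{\partial\psi_j^i(\mathbf{x})}{\partial x_l}\right)_{l=1}^{d}$. The functions $\varphi_j^i(\mathbf{x})$ and $\psi_j^i(\mathbf{x})$ satisfy the equations $$\nabla^T\left(\mathcal{N}(\mathbf{x};X_t^i,\Sigma)\nabla\varphi_j^i(\mathbf{x})\right)=\left(-h_j(\mathbf{x})+C_j^i\right)\mathcal{N}(\mathbf{x};X_t^i,\Sigma),$$ for any constant $C_j^i$, and $$\nabla^T\left(\nabla_{\vec\lambda}\psi_j^i(\mathbf{x})\right)=\left(\hat h_j^{N_p}-C_j^i\right)\mathcal{N}(\mathbf{x};X_t^i,\Sigma),$$ respectively.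
   Context: Here $\mathbf{x}\in\mathbb{R}^d$, the time $t$ is fixed, $\nabla$ is the gradient and $\nabla^T$ the divergence operator on $\mathbb{R}^d$. The points $X_t^1,\dots,X_t^{N_p}\in\mathbb{R}^d$ are the particles, $\Sigma$ is an invertible $d\times d$ covariance matrix, and $$\mathcal{N}(\mathbf{x};X_t^i,\Sigma)=\frac{1}{(2\pi)^{d/2}|\Sigma|^{1/2}}\exp\left\{-\frac12(\mathbf{x}-X_t^i)^T\Sigma^{-1}(\mathbf{x}-X_t^i)\right\}$$ is the multivariate Gaussian density. The posterior density is approximated by $p_t^{N_p,\Sigma}(\mathbf{x})=\frac{1}{N_p}\sum_{i=1}^{N_p}\mathcal{N}(\mathbf{x};X_t^i,\Sigma)$. The observation function $h=(h_1,\dots,h_m):\mathbb{R}^d\to\mathbb{R}^m$ has polynomial components, and $\hat h_j^{N_p}=\int_{\mathbb{R}^d}h_j(\mathbf{x})\,p_t^{N_p,\Sigma}(\mathbf{x})\,d\mathbf{x}$. The gain matrix $K$ (with values in $\mathbb{R}^{d\times m}$) of the feedback particle filter is sought in gradient form: one considers a vector-valued function $\varphi=[\varphi_1,\dots,\varphi_m]$ such that the $j$-th column of $K$ is $K_{\cdot j}=\nabla\varphi_j$ for each $j=1,\dots,m$; the equation for $K$, namely $\nabla^T(p_t^{N_p,\Sigma}K)=-(h-\hat h^{N_p})^Tp_t^{N_p,\Sigma}$ with $\hat h^{N_p}=(\hat h_1^{N_p},\dots,\hat h_m^{N_p})$, then becomes the displayed equation for $\nabla\varphi_j$, $j=1,\dots,m$.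 The index $i$ runs over $1,\dots,N_p$.
   Formalization: The formula's field is shown to solve the gain equation in place of ∇φ_j, and any φ_j with this gradient solves it; that such a φ_j exists, or that the gain is unique, is not claimed, since for arbitrary φ_j^i, ψ_j^i the field need not be a gradient (e.g. d=2, ψ=x_1). *)

theory Defs
  imports "HOL-Analysis.Analysis"
begin

definition grad :: "(real ^ 'd \<Rightarrow> real) \<Rightarrow> real ^ 'd \<Rightarrow> real ^ 'd" where
  "grad f x = (\<chi> l. frechet_derivative f (at x) (axis l 1))"

definition divergence :: "(real ^ 'd \<Rightarrow> real ^ 'd) \<Rightarrow> real ^ 'd \<Rightarrow> real" where
  "divergence F x = (\<Sum>l\<in>UNIV. frechet_derivative F (at x) (axis l 1) $ l)"

text \<open>The library's \<^const>\<open>frechet_derivative\<close> is a total function with an unspecified value at points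
  of non-differentiability, so the classical reading of a second-order equation needs the
  following regularity. It is weaker than being twice continuously differentiable.\<close>

definition twice_differentiable :: "(real ^ 'd \<Rightarrow> real) \<Rightarrow> bool" where
  "twice_differentiable f \<longleftrightarrow> f differentiable_on UNIV \<and> grad f differentiable_on UNIV"

definition covariance_matrix :: "real ^ 'd ^ 'd \<Rightarrow> bool" where
  "covariance_matrix S \<longleftrightarrow> transpose S = S \<and> (\<forall>v. 0 \<le> v \<bullet> (S *v v))"

text \<open>The components of \<open>lam\<close> are the roots, with multiplicity and in an arbitrary order, of the
  characteristic polynomial of \<open>A\<close>; note that \<^term>\<open>mat t\<close> is \<open>t\<close> times the identity matrix.\<close>

definition eigenvalues :: "real ^ 'd ^ 'd \<Rightarrow> real ^ 'd \<Rightarrow> bool" where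
  "eigenvalues A lam \<longleftrightarrow> (\<forall>t. det (mat t - A) = (\<Prod>l\<in>UNIV. t - lam $ l))"

definition gaussian :: "real ^ 'd \<Rightarrow> real ^ 'd ^ 'd \<Rightarrow> real ^ 'd \<Rightarrow> real" where
  "gaussian \<mu> S x =
     1 / ((2 * pi) powr (real CARD('d) / 2) * det S powr (1 / 2)) *
     exp (- (1 / 2) * ((x - \<mu>) \<bullet> (matrix_inv S *v (x - \<mu>))))"

definition posterior :: "nat \<Rightarrow> (nat \<Rightarrow> real ^ 'd) \<Rightarrow> real ^ 'd ^ 'd \<Rightarrow> real ^ 'd \<Rightarrow> real" where
  "posterior Np X S x = 1 / real Np * (\<Sum>i=1..Np. gaussian (X i) S x)"

definition obs_mean ::
  "nat \<Rightarrow> (nat \<Rightarrow> real ^ 'd) \<Rightarrow> real ^ 'd ^ 'd \<Rightarrow> (real ^ 'd \<Rightarrow> real ^ 'm) \<Rightarrow> real ^ 'm" where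
  "obs_mean Np X S h = (\<chi> j. LINT x|lborel. h x $ j * posterior Np X S x)"

definition grad_lam :: "real ^ 'd \<Rightarrow> (real ^ 'd \<Rightarrow> real) \<Rightarrow> real ^ 'd \<Rightarrow> real ^ 'd" where
  "grad_lam lam \<psi> x = (\<chi> l. 1 / lam $ l * grad \<psi> x $ l)"

text \<open>The equation for the \<open>j\<close>-th column \<open>G\<close> of the gain matrix; it is the equation for a potential
  \<open>f\<close> when \<open>G = grad f\<close>.\<close>

definition gain_equation ::
  "nat \<Rightarrow> (nat \<Rightarrow> real ^ 'd) \<Rightarrow> real ^ 'd ^ 'd \<Rightarrow> (real ^ 'd \<Rightarrow> real ^ 'm) \<Rightarrow> 'm \<Rightarrow>
   (real ^ 'd \<Rightarrow> real ^ 'd) \<Rightarrow> bool" where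
  "gain_equation Np X S h j G \<longleftrightarrow>
     G differentiable_on UNIV \<and>
     (\<forall>x. divergence (\<lambda>y. posterior Np X S y *\<^sub>R G y) x =
          - (h x $ j - obs_mean Np X S h $ j) * posterior Np X S x)"

definition gain_formula ::
  "nat \<Rightarrow> (nat \<Rightarrow> real ^ 'd) \<Rightarrow> real ^ 'd ^ 'd \<Rightarrow> real ^ 'd \<Rightarrow>
   (nat \<Rightarrow> real ^ 'd \<Rightarrow> real) \<Rightarrow> (nat \<Rightarrow> real ^ 'd \<Rightarrow> real) \<Rightarrow> real ^ 'd \<Rightarrow> real ^ 'd" where
  "gain_formula Np X S lam \<phi> \<psi> x =
     (1 / (\<Sum>i=1..Np. gaussian (X i) S x)) *\<^sub>R
     (\<Sum>i=1..Np. grad_lam lam (\<psi> i) x + gaussian (X i) S x *\<^sub>R grad (\<phi> i) x)"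

end

theory Submission
  imports Defs
begin

text \<open>The sum of the Gaussians in the denominator of the formula is \<open>Np\<close> times
  the posterior density. Multiplying the proposed gain by the posterior therefore removes the
  quotient and leaves the average of the fields \<open>V i = grad_lam lam (\<psi> i) + N i *\<^sub>R
  grad (\<phi> i)\<close>. The divergence is linear on differentiable fields, and in the divergence
  of \<open>V i\<close> the two given equations add up so that the constant \<open>C i\<close> drops
  out, leaving \<open>(hhat - h x $ j) * N i x\<close>. Averaging over \<open>i\<close> turns the
  Gaussians back into the posterior, which is the gain equation. The carrying facts are
  \<open>gaussian_pos\<close>, which makes the quotient legitimate and differentiable, and
  \<open>divergence_add\<close>, \<open>divergence_sum\<close>,
  \<open>divergence_scaleR\<close>.\<close>

text \<open>A real \<open>powr\<close> with nonzero base is an exponential, so the normalising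
  constant is positive as soon as \<open>det S\<close> does not vanish.\<close>

lemma gaussian_pos:
  assumes "invertible S"
  shows "0 < gaussian \<mu> S x"
proof -
  have "det S \<noteq> 0"
    using assms by (simp add: invertible_det_nz)
  then show ?thesis
    by (simp add: gaussian_def)
qed

lemma gaussian_differentiable: "gaussian \<mu> S differentiable at x"
proof -
  have "(\<lambda>y. y - \<mu>) differentiable at x"
    by simp
  moreover have "((\<lambda>y. matrix_inv S *v (y - \<mu>)) has_derivative (\<lambda>v. matrix_inv S *v v)) (at x)"
    by (rule bounded_linear.has_derivative [OF matrix_vector_mul_bounded_linear])
      (auto intro!: derivative_eq_intros)
  then have "(\<lambda>y. matrix_inv S *v (y - \<mu>)) differentiable at x"
    by (rule differentiableI)
  ultimately have "(\<lambda>y. (y - \<mu>) \<bullet> (matrix_inv S *v (y - \<mu>))) differentiable at x"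
    by (rule differentiable_inner)
  then obtain D where
    "((\<lambda>y. (y - \<mu>) \<bullet> (matrix_inv S *v (y - \<mu>))) has_derivative D) (at x)"
    by (auto simp: differentiable_def)
  then show ?thesis
    unfolding gaussian_def [abs_def] differentiable_def
    \<comment> \<open>The derivative stays schematic and is built by the rules;
      \<open>assumption\<close> supplies \<open>D\<close> for the quadratic form in the
      exponent.\<close>
    by (intro exI) (assumption | rule derivative_intros)+
qed

text \<open>The field is the gradient followed by a fixed diagonal linear map, so the chain rule
  applies.\<close>

lemma grad_lam_differentiable:
  assumes "twice_differentiable f"
  shows "grad_lam lam f differentiable at x"
proof -
  obtain D where D: "(grad f has_derivative D) (at x)"
    using assms by (auto simp: twice_differentiable_def differentiable_on_def differentiable_def)
  have "bounded_linear (\<lambda>v :: real ^ 'a. \<chi> l. 1 / lam $ l * v $ l)"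
    unfolding linear_conv_bounded_linear [symmetric]
    by (rule linearI) (simp_all add: vec_eq_iff algebra_simps add_divide_distrib)
  from bounded_linear.has_derivative [OF this D]
  show ?thesis
    unfolding differentiable_def grad_lam_def [abs_def] by blast
qed

text \<open>Differentiability makes \<open>frechet_derivative\<close> a genuine derivative, and
  uniqueness of derivatives then transfers linearity to the divergence. The next two lemmas follow
  the same pattern.\<close>

lemma divergence_add:
  assumes "F differentiable at x" and "G differentiable at x"
  shows "divergence (\<lambda>y. F y + G y) x = divergence F x + divergence G x"
proof -
  have "((\<lambda>y. F y + G y) has_derivative
      (\<lambda>v. frechet_derivative F (at x) v + frechet_derivative G (at x) v)) (at x)"
    using assms by (intro has_derivative_add) (simp_all add: frechet_derivative_works)
  then show ?thesis
    by (simp add: divergence_def frechet_derivative_at [symmetric] sum.distrib)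
qed

lemma divergence_sum:
  assumes "\<And>i. i \<in> I \<Longrightarrow> F i differentiable at x"
  shows "divergence (\<lambda>y. \<Sum>i\<in>I. F i y) x = (\<Sum>i\<in>I. divergence (F i) x)"
proof -
  have "((\<lambda>y. \<Sum>i\<in>I. F i y) has_derivative (\<lambda>v. \<Sum>i\<in>I. frechet_derivative (F i) (at x) v)) (at x)"
    using assms by (intro has_derivative_sum) (simp add: frechet_derivative_works)
  then have "divergence (\<lambda>y. \<Sum>i\<in>I. F i y) x
      = (\<Sum>l\<in>UNIV. \<Sum>i\<in>I. frechet_derivative (F i) (at x) (axis l 1) $ l)"
    by (simp add: divergence_def frechet_derivative_at [symmetric])
  also have "\<dots> = (\<Sum>i\<in>I. divergence (F i) x)"
    unfolding divergence_def by (rule sum.swap)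
  finally show ?thesis .
qed

lemma divergence_scaleR:
  assumes "F differentiable at x"
  shows "divergence (\<lambda>y. c *\<^sub>R F y) x = c * divergence F x"
proof -
  have "((\<lambda>y. c *\<^sub>R F y) has_derivative (\<lambda>v. c *\<^sub>R frechet_derivative F (at x) v)) (at x)"
    using assms by (intro has_derivative_scaleR_right) (simp add: frechet_derivative_works)
  then show ?thesis
    by (simp add: divergence_def frechet_derivative_at [symmetric] sum_distrib_left)
qed

theorem mainTheorem1:
  fixes Np :: nat
    and X :: "nat \<Rightarrow> real ^ 'd"
    and S :: "real ^ 'd ^ 'd"
    and lam :: "real ^ 'd"
    and h :: "real ^ 'd \<Rightarrow> real ^ 'm"
    and j :: 'm
    and C :: "nat \<Rightarrow> real"
    and \<phi> \<psi> :: "nat \<Rightarrow> real ^ 'd \<Rightarrow> real"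
  assumes "1 \<le> Np"
    and "covariance_matrix S" and "invertible S"
    and "eigenvalues (matrix_inv S) lam"
    and "\<And>k. real_polynomial_function (\<lambda>x. h x $ k)"
    and "\<And>i. i \<in> {1..Np} \<Longrightarrow> twice_differentiable (\<phi> i)"
    and "\<And>i. i \<in> {1..Np} \<Longrightarrow> twice_differentiable (\<psi> i)"
    and "\<And>i x. i \<in> {1..Np} \<Longrightarrow>
           divergence (\<lambda>y. gaussian (X i) S y *\<^sub>R grad (\<phi> i) y) x =
           (- (h x $ j) + C i) * gaussian (X i) S x"
    and "\<And>i x. i \<in> {1..Np} \<Longrightarrow>
           divergence (grad_lam lam (\<psi> i)) x =
           (obs_mean Np X S h $ j - C i) * gaussian (X i) S x"
  shows "gain_equation Np X S h j (gain_formula Np X S lam \<phi> \<psi>) \<and>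
         (\<forall>\<Phi>. \<Phi> differentiable_on UNIV \<and>
              (\<forall>x. grad \<Phi> x = gain_formula Np X S lam \<phi> \<psi> x) \<longrightarrow>
              gain_equation Np X S h j (grad \<Phi>))"
proof -
  note one_le_Np = assms(1) and phi_eq = assms(8) and psi_eq = assms(9)
  define N where "N i = gaussian (X i) S" for i
  define flux where "flux i y = N i y *\<^sub>R grad (\<phi> i) y" for i y
  define V where "V i y = grad_lam lam (\<psi> i) y + flux i y" for i y
  define hhat where "hhat = obs_mean Np X S h $ j"
  have N_diff: "N i differentiable at x" for i x
    unfolding N_def by (rule gaussian_differentiable)
  \<comment> \<open>\<open>1 \<le> Np\<close> makes the index set nonempty, so the sum is strictly
    positive.\<close>
  have total_pos: "0 < (\<Sum>i=1..Np. N i x)" for x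
    unfolding N_def using one_le_Np \<open>invertible S\<close> by (intro sum_pos) (auto intro: gaussian_pos)
  have flux_diff: "flux i differentiable at x" if "i \<in> {1..Np}" for i x
  proof -
    have "grad (\<phi> i) differentiable at x"
      using assms(6) [OF that] by (simp add: twice_differentiable_def differentiable_on_def)
    then show ?thesis
      unfolding flux_def [abs_def] using N_diff by (intro differentiable_scaleR)
  qed
  have psi_diff: "grad_lam lam (\<psi> i) differentiable at x" if "i \<in> {1..Np}" for i x
    using assms(7) [OF that] by (rule grad_lam_differentiable)
  have V_diff: "V i differentiable at x" if "i \<in> {1..Np}" for i x
    unfolding V_def [abs_def] using psi_diff [OF that] flux_diff [OF that]
    by (rule differentiable_add)
  have sum_V_diff: "(\<lambda>y. \<Sum>i=1..Np. V i y) differentiable at x" for x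
    using V_diff by (intro differentiable_sum) auto
  \<comment> \<open>Writing the factor with \<open>inverse\<close> lets
    \<open>differentiable_inverse\<close> apply below.\<close>
  have formula: "gain_formula Np X S lam \<phi> \<psi>
      = (\<lambda>y. inverse (\<Sum>i=1..Np. N i y) *\<^sub>R (\<Sum>i=1..Np. V i y))"
    by (simp add: fun_eq_iff gain_formula_def N_def V_def flux_def inverse_eq_divide)
  have formula_diff: "gain_formula Np X S lam \<phi> \<psi> differentiable at x" for x
    unfolding formula using N_diff total_pos [of x]
    by (intro differentiable_scaleR differentiable_inverse sum_V_diff differentiable_sum) auto
  \<comment> \<open>The normalising factor of the formula cancels against the posterior density.\<close>
  have cancel: "posterior Np X S y *\<^sub>R gain_formula Np X S lam \<phi> \<psi> y
      = (1 / real Np) *\<^sub>R (\<Sum>i=1..Np. V i y)" for y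
    using total_pos [of y] by (simp add: formula posterior_def flip: N_def)
  \<comment> \<open>Here \<open>C i\<close> cancels: it enters the two equations with opposite signs
    and the same weight \<open>N i x\<close>.\<close>
  have div_V: "divergence (V i) x = (hhat - h x $ j) * N i x" if "i \<in> {1..Np}" for i x
  proof -
    have "divergence (V i) x = divergence (grad_lam lam (\<psi> i)) x + divergence (flux i) x"
      unfolding V_def [abs_def] using psi_diff [OF that] flux_diff [OF that]
      by (rule divergence_add)
    also have "\<dots> = (hhat - C i) * N i x + (- (h x $ j) + C i) * N i x"
      using phi_eq [OF that] psi_eq [OF that] by (simp add: flux_def [abs_def] N_def hhat_def)
    finally show ?thesis
      by (simp add: algebra_simps)
  qed
  have div_gain: "divergence (\<lambda>y. posterior Np X S y *\<^sub>R gain_formula Np X S lam \<phi> \<psi> y) x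
      = - (h x $ j - hhat) * posterior Np X S x" for x
  proof -
    have "divergence (\<lambda>y. posterior Np X S y *\<^sub>R gain_formula Np X S lam \<phi> \<psi> y) x
        = 1 / real Np * (\<Sum>i=1..Np. divergence (V i) x)"
      unfolding cancel divergence_scaleR [OF sum_V_diff] using V_diff by (subst divergence_sum) auto
    also have "\<dots> = 1 / real Np * ((hhat - h x $ j) * (\<Sum>i=1..Np. N i x))"
      by (simp add: div_V sum_distrib_left)
    finally show ?thesis
      by (simp add: posterior_def N_def)
  qed
  have gain: "gain_equation Np X S h j (gain_formula Np X S lam \<phi> \<psi>)"
    using formula_diff div_gain
    by (auto simp: gain_equation_def differentiable_on_def hhat_def)
  \<comment> \<open>Pointwise agreement is equality of functions, so the equation carries over to
    any potential with this gradient.\<close>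
  moreover have "gain_equation Np X S h j (grad \<Phi>)"
    if "\<forall>x. grad \<Phi> x = gain_formula Np X S lam \<phi> \<psi> x" for \<Phi>
  proof -
    from that have "grad \<Phi> = gain_formula Np X S lam \<phi> \<psi>"
      by (simp add: fun_eq_iff)
    with gain show ?thesis
      by simp
  qed
  ultimately show ?thesis
    by blast
qed

end
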